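(* Let $L : \mathbb{R}^m \to [-\infty,\infty)$ be continuous and concave, coercive in the sense that $L(\boldsymbol{\psi}) \to -\infty$ as $\|\boldsymbol{\psi}\| \to \infty$, and continuously differentiable on $\mathrm{dom}(L) := \{\boldsymbol{\psi} \in \mathbb{R}^m : L(\boldsymbol{\psi}) > -\infty\}$. Let $\boldsymbol{v}_1,\ldots,\boldsymbol{v}_q \in \mathbb{R}^m$ be linearly independent, $c_1,\ldots,c_q \in \mathbb{R}$, and $\mathcal{K} := \{\boldsymbol{\psi} \in \mathbb{R}^m : \boldsymbol{v}_i^\top\boldsymbol{\psi} \le c_i \text{ for } i = 1,\ldots,q\}$. Let $\boldsymbol{b}_1,\ldots,\boldsymbol{b}_m$ be a basis of $\mathbb{R}^m$ such that, for $1 \le i \le q$ and $1 \le j \le m$, $\boldsymbol{v}_i^\top \boldsymbol{b}_j < 0$ if $i = j$ and $\boldsymbol{v}_i^\top\boldsymbol{b}_j = 0$ if $i \neq j$. Let $\tilde{\boldsymbol{\psi}}(\cdot)$ be a map assigning to each $A \subseteq \{1,\ldots,q\}$ with $\mathcal{V}(A) \cap \mathrm{dom}(L) \neq \emptyset$ a point $\tilde{\boldsymbol{\psi}}(A)$ that maximizes $L$ over $\mathcal{V}(A)$. Then for every starting point $\boldsymbol{\psi}_o \in \mathcal{K} \cap \mathrm{dom}(L)$ the algorithm ActiveSet1 (defined in the context, carried out in exact arithmetic) terminates after finitely many steps, and the resulting vector $\boldsymbol{\psi}$ belongs to $\mathcal{K}_* := \mathop{\rm argmax}_{\boldsymbol{\psi}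 \in \mathcal{K}} L(\boldsymbol{\psi})$, the set of maximizers of $L$ over $\mathcal{K}$.
   Context: Notation: $A(\boldsymbol{\psi}) := \{ i \in \{1,\ldots,q\} : \boldsymbol{v}_i^\top\boldsymbol{\psi} \ge c_i\}$ for $\boldsymbol{\psi} \in \mathbb{R}^m$; $\mathcal{V}(A) := \{\boldsymbol{\psi} \in \mathbb{R}^m : \boldsymbol{v}_a^\top\boldsymbol{\psi} = c_a \text{ for all } a \in A\}$ for $A \subseteq \{1,\ldots,q\}$. For the current point $\boldsymbol{\psi} \in \mathcal{K}$ and a candidate $\boldsymbol{\psi}_{\rm cand} \notin \mathcal{K}$, $$t(\boldsymbol{\psi},\boldsymbol{\psi}_{\rm cand}) := \max\{t \in (0,1) : (1-t)\boldsymbol{\psi} + t\boldsymbol{\psi}_{\rm cand} \in \mathcal{K}\} = \min\Bigl\{ \frac{c_i - \boldsymbol{v}_i^\top\boldsymbol{\psi}}{\boldsymbol{v}_i^\top\boldsymbol{\psi}_{\rm cand} - \boldsymbol{v}_i^\top\boldsymbol{\psi}} : 1 \le i \le q,\ \boldsymbol{v}_i^\top\boldsymbol{\psi}_{\rm cand} > c_i \Bigr\} .$$ Algorithm ActiveSet1 with input $\boldsymbol{\psi}_o$ (a maximum over the empty set is read as $-\infty$): 1. Set $\boldsymbol{\psi} \leftarrow \boldsymbol{\psi}_o$; $A \leftarrow A(\boldsymbol{\psi})$; $\boldsymbol{\psi}_{\rm cand} \leftarrow \tilde{\boldsymbol{\psi}}(A)$. 2. While $\boldsymbol{\psi}_{\rm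 cand} \notin \mathcal{K}$: set $\boldsymbol{\psi} \leftarrow (1 - t(\boldsymbol{\psi},\boldsymbol{\psi}_{\rm cand}))\boldsymbol{\psi} + t(\boldsymbol{\psi},\boldsymbol{\psi}_{\rm cand})\boldsymbol{\psi}_{\rm cand}$; then $A \leftarrow A(\boldsymbol{\psi})$; then $\boldsymbol{\psi}_{\rm cand} \leftarrow \tilde{\boldsymbol{\psi}}(A)$. 3. Set $\boldsymbol{\psi} \leftarrow \boldsymbol{\psi}_{\rm cand}$; $A \leftarrow A(\boldsymbol{\psi})$. 4. While $\max_{a \in A} \boldsymbol{b}_a^\top \nabla L(\boldsymbol{\psi}) > 0$: (i) let $a$ be the smallest index in $\mathop{\rm argmax}_{a \in A} \boldsymbol{b}_a^\top\nabla L(\boldsymbol{\psi})$; set $A \leftarrow A \setminus \{a\}$; $\boldsymbol{\psi}_{\rm cand} \leftarrow \tilde{\boldsymbol{\psi}}(A)$; (ii) while $\boldsymbol{\psi}_{\rm cand} \notin \mathcal{K}$: set $\boldsymbol{\psi} \leftarrow (1 - t(\boldsymbol{\psi},\boldsymbol{\psi}_{\rm cand}))\boldsymbol{\psi} + t(\boldsymbol{\psi},\boldsymbol{\psi}_{\rm cand})\boldsymbol{\psi}_{\rm cand}$; then $A \leftarrow A(\boldsymbol{\psi})$; then $\boldsymbol{\psi}_{\rm cand} \leftarrow \tilde{\boldsymbol{\psi}}(A)$; (iii) set $\boldsymbol{\psi} \leftarrow \boldsymbol{\psi}_{\rm cand}$; $A \leftarrow A(\boldsymbol{\psi})$. 5.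 Return $\boldsymbol{\psi}$. *)

theory Defs
  imports "HOL-Analysis.Analysis"
begin

definition argmax_on :: "('a \<Rightarrow> 'b::ord) \<Rightarrow> 'a set \<Rightarrow> 'a set" where
  "argmax_on f S = {x. is_arg_max f (\<lambda>x. x \<in> S) x}"

definition effdom :: "('v \<Rightarrow> ereal) \<Rightarrow> 'v set" where
  "effdom L = {\<psi>. L \<psi> > -\<infinity>}"

definition concave_ereal :: "('v::real_vector \<Rightarrow> ereal) \<Rightarrow> bool" where
  "concave_ereal L \<longleftrightarrow>
     (\<forall>x y. \<forall>t\<in>{0..1}. ereal (1 - t) * L x + ereal t * L y \<le> L ((1 - t) *\<^sub>R x + t *\<^sub>R y))"

definition grad :: "('v::real_inner \<Rightarrow> ereal) \<Rightarrow> 'v \<Rightarrow> 'v" where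
  "grad L \<psi> = (THE D. GDERIV (\<lambda>x. real_of_ereal (L x)) \<psi> :> D)"

(* For L continuous with values below \<infinity> the effective domain is open, so "at" is the
   two-sided derivative there and the value 0 that real_of_ereal takes off it is irrelevant. *)
definition cont_differentiable_on_effdom :: "('v::euclidean_space \<Rightarrow> ereal) \<Rightarrow> bool" where
  "cont_differentiable_on_effdom L \<longleftrightarrow>
     (\<forall>\<psi>\<in>effdom L. (\<lambda>x. real_of_ereal (L x)) differentiable (at \<psi>)) \<and>
     continuous_on (effdom L) (grad L)"

(* Partial operations and loops are option-valued: None stands for an undefined step or for
   a run that does not terminate. *)

context
  fixes v :: "nat \<Rightarrow> 'v::euclidean_space" and c :: "nat \<Rightarrow> real" and q :: nat
begin

definition feasible :: "'v set" where
  "feasible = {\<psi>. \<forall>i\<in>{1..q}. v i \<bullet> \<psi> \<le> c i}"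

definition active :: "'v \<Rightarrow> nat set" where
  "active \<psi> = {i\<in>{1..q}. v i \<bullet> \<psi> \<ge> c i}"

definition step_admissible :: "'v \<Rightarrow> 'v \<Rightarrow> real \<Rightarrow> bool" where
  "step_admissible \<psi> cand t \<longleftrightarrow> 0 < t \<and> t < 1 \<and> (1 - t) *\<^sub>R \<psi> + t *\<^sub>R cand \<in> feasible"

(* None if the set of admissible t in (0,1) has no maximum. *)
definition step_length :: "'v \<Rightarrow> 'v \<Rightarrow> real option" where
  "step_length \<psi> cand =
     (if \<exists>t. step_admissible \<psi> cand t \<and> (\<forall>s. step_admissible \<psi> cand s \<longrightarrow> s \<le> t)
      then Some (GREATEST t. step_admissible \<psi> cand t) else None)"

lemma step_length_eq_Min:
  assumes "\<psi> \<in> feasible" and "cand \<notin> feasible"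
    and slack: "\<And>i. \<lbrakk>i \<in> {1..q}; v i \<bullet> cand > c i\<rbrakk> \<Longrightarrow> v i \<bullet> \<psi> < c i"
  shows "step_length \<psi> cand =
    Some (Min ((\<lambda>i. (c i - v i \<bullet> \<psi>) / (v i \<bullet> cand - v i \<bullet> \<psi>)) ` {i\<in>{1..q}. v i \<bullet> cand > c i}))"
proof -
  define I where "I = {i\<in>{1..q}. v i \<bullet> cand > c i}"
  define r where "r = (\<lambda>i. (c i - v i \<bullet> \<psi>) / (v i \<bullet> cand - v i \<bullet> \<psi>))"
  have fin: "finite (r ` I)" by (simp add: I_def)
  have ne: "r ` I \<noteq> {}"
  proof -
    obtain i where "i \<in> {1..q}" "\<not> v i \<bullet> cand \<le> c i"
      using assms(2) unfolding feasible_def by blast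
    then have "i \<in> I" by (simp add: I_def)
    then show ?thesis by blast
  qed
  have r: "0 < r i \<and> r i < 1" if "i \<in> I" for i
    using that slack[of i] by (auto simp: I_def r_def)
  have adm: "step_admissible \<psi> cand t \<longleftrightarrow> 0 < t \<and> (\<forall>i\<in>I. t \<le> r i)" for t
  proof -
    have violated: "v i \<bullet> ((1 - t) *\<^sub>R \<psi> + t *\<^sub>R cand) \<le> c i \<longleftrightarrow> t \<le> r i" if "i \<in> I" for i
    proof -
      have "v i \<bullet> cand - v i \<bullet> \<psi> > 0" using that slack[of i] by (auto simp: I_def)
      then show ?thesis
        unfolding r_def by (simp add: inner_add_right pos_le_divide_eq) (simp add: algebra_simps)
    qed
    have other: "v i \<bullet> ((1 - t) *\<^sub>R \<psi> + t *\<^sub>R cand) \<le> c i"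
      if "i \<in> {1..q} - I" "0 < t" "t < 1" for i
    proof -
      have "v i \<bullet> \<psi> \<le> c i" "v i \<bullet> cand \<le> c i"
        using that assms(1) by (auto simp: I_def feasible_def)
      then show ?thesis
        using convex_bound_le[of "v i \<bullet> \<psi>" "c i" "v i \<bullet> cand" "1 - t" t] that
        by (simp add: inner_add_right)
    qed
    have lt1: "t < 1" if "\<forall>i\<in>I. t \<le> r i"
    proof -
      obtain i where "i \<in> I" using ne by blast
      then show ?thesis using that r[of i] by fastforce
    qed
    have "I \<subseteq> {1..q}" by (auto simp: I_def)
    then show ?thesis
      unfolding step_admissible_def feasible_def using violated other lt1 by blast
  qed
  have max: "step_admissible \<psi> cand (Min (r ` I))"
    "\<forall>s. step_admissible \<psi> cand s \<longrightarrow> s \<le> Min (r ` I)"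
    using fin ne r by (auto simp: adm)
  have great: "(GREATEST t. step_admissible \<psi> cand t) = Min (r ` I)"
    using max by (intro Greatest_equality) auto
  have "step_length \<psi> cand = Some (Min (r ` I))"
    unfolding step_length_def great using max by (simp only: if_P exI[of _ "Min (r ` I)"])
  then show ?thesis by (simp only: I_def r_def)
qed

definition eq_space :: "nat set \<Rightarrow> 'v set" where
  "eq_space A = {\<psi>. \<forall>a\<in>A. v a \<bullet> \<psi> = c a}"

context
  fixes L :: "'v \<Rightarrow> ereal" and psi_tilde :: "nat set \<Rightarrow> 'v"
begin

definition candidate :: "nat set \<Rightarrow> 'v option" where
  "candidate A = (if eq_space A \<inter> effdom L \<noteq> {} then Some (psi_tilde A) else None)"

(* The inner loop, including the assignment of the candidate to \<psi> that follows it;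
   A needs no slot in the state, since every iteration resets it to active \<psi>. *)
partial_function (option) move_to_candidate :: "'v \<Rightarrow> 'v \<Rightarrow> 'v option" where
  "move_to_candidate \<psi> cand =
     (if cand \<in> feasible then Some cand
      else Option.bind (step_length \<psi> cand) (\<lambda>t.
        let \<psi>' = (1 - t) *\<^sub>R \<psi> + t *\<^sub>R cand; A = active \<psi>'
        in Option.bind (candidate A) (\<lambda>cand'. move_to_candidate \<psi>' cand')))"

(* The outer loop; since max {} = -\<infinity>, its condition fails for empty A. *)
partial_function (option) release_loop :: "(nat \<Rightarrow> 'v) \<Rightarrow> 'v \<Rightarrow> nat set \<Rightarrow> 'v option" where
  "release_loop b \<psi> A =
     (if A \<noteq> {} \<and> Max ((\<lambda>a. b a \<bullet> grad L \<psi>) ` A) > 0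
      then let a = (LEAST a. a \<in> argmax_on (\<lambda>a. b a \<bullet> grad L \<psi>) A); A' = A - {a}
        in Option.bind (candidate A') (\<lambda>cand.
           Option.bind (move_to_candidate \<psi> cand) (\<lambda>\<psi>'.
           release_loop b \<psi>' (active \<psi>')))
      else Some \<psi>)"

definition ActiveSet1 :: "(nat \<Rightarrow> 'v) \<Rightarrow> 'v \<Rightarrow> 'v option" where
  "ActiveSet1 b \<psi>\<^sub>o =
     Option.bind (candidate (active \<psi>\<^sub>o)) (\<lambda>cand.
     Option.bind (move_to_candidate \<psi>\<^sub>o cand) (\<lambda>\<psi>.
     release_loop b \<psi> (active \<psi>)))"

end

end

end

(* Releasing the constraint a is an ascent step: grad L has a positive component along b a,
   and since the current point maximizes L on its active face, concavity forces the new
   candidate onto the feasible side of constraint a. Hence the step length exists and is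
   positive, and L increases strictly. Each pass of the inner loop enlarges the active set,
   and each pass of the outer loop ends in a point psi_tilde A with a larger value of L, so
   both loops are finite. On exit, K lies in the cone psi + cone(b a : a active) +
   (directions of the face), along which grad L is nonpositive; concavity makes this global. *)
theory Submission
  imports Defs
begin

section \<open>Existence and uniqueness of the gradient\<close>

text \<open>\<open>grad\<close> is a definite description, so it must be shown to denote. In finite
  dimension the linear derivative is the inner product with the vector of its values on
  \<open>Basis\<close>, and derivatives are unique.\<close>

lemma GDERIV_grad:
  fixes L :: "'v::euclidean_space \<Rightarrow> ereal"
  assumes "(\<lambda>x. real_of_ereal (L x)) differentiable (at \<psi>)"
  shows "GDERIV (\<lambda>x. real_of_ereal (L x)) \<psi> :> grad L \<psi>"
proof -
  let ?l = "\<lambda>x. real_of_ereal (L x)"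
  obtain f' where f': "(?l has_derivative f') (at \<psi>)"
    using assms unfolding differentiable_def by blast
  then interpret f': linear f' by (rule has_derivative_linear)
  define D where "D = (\<Sum>i\<in>Basis. f' i *\<^sub>R i)"
  have "f' = (\<lambda>h. h \<bullet> D)"
  proof
    fix h
    have "f' h = f' (\<Sum>i\<in>Basis. (h \<bullet> i) *\<^sub>R i)" by (simp add: euclidean_representation)
    also have "\<dots> = (\<Sum>i\<in>Basis. (h \<bullet> i) * f' i)" by (simp add: f'.sum f'.scale)
    also have "\<dots> = h \<bullet> D" by (simp add: D_def inner_sum_right mult.commute)
    finally show "f' h = h \<bullet> D" .
  qed
  then have D: "GDERIV ?l \<psi> :> D" using f' by (simp add: gderiv_def)
  moreover have "E = D" if "GDERIV ?l \<psi> :> E" for E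
  proof -
    have "(\<lambda>h. h \<bullet> E) = (\<lambda>h. h \<bullet> D)"
      using that D unfolding gderiv_def by (rule has_derivative_unique)
    then have "\<forall>h. h \<bullet> E = h \<bullet> D" by (simp add: fun_eq_iff)
    then show ?thesis by (simp only: vector_eq_ldot)
  qed
  ultimately have "grad L \<psi> = D" unfolding grad_def by (rule the_equality)
  then show ?thesis using D by simp
qed

text \<open>For indices up to \<open>q\<close>, the \<open>b j\<close> are dual to the
  \<open>v i\<close> up to negative factors: adding a positive multiple of \<open>b a\<close> lowers
  the value of constraint \<open>a\<close> and fixes the others.\<close>

locale active_set_problem =
  fixes L :: "'v::euclidean_space \<Rightarrow> ereal" and v b :: "nat \<Rightarrow> 'v" and c :: "nat \<Rightarrow> real"
    and q :: nat and psi_tilde :: "nat set \<Rightarrow> 'v"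
  assumes L_less_top: "L x < \<infinity>"
    and continuous_L: "continuous_on UNIV L"
    and concave_L: "concave_ereal L"
    and differentiable_L: "x \<in> effdom L \<Longrightarrow> (\<lambda>x. real_of_ereal (L x)) differentiable (at x)"
    and v_b_neg: "i \<in> {1..q} \<Longrightarrow> v i \<bullet> b i < 0"
    and v_b_orth: "i \<in> {1..q} \<Longrightarrow> j \<in> {1..q} \<Longrightarrow> i \<noteq> j \<Longrightarrow> v i \<bullet> b j = 0"
    and psi_tilde_argmax: "A \<subseteq> {1..q} \<Longrightarrow> eq_space v c A \<inter> effdom L \<noteq> {} \<Longrightarrow>
      psi_tilde A \<in> argmax_on L (eq_space v c A)"
begin

abbreviation "l \<equiv> \<lambda>x. real_of_ereal (L x)"

abbreviation "\<K> \<equiv> feasible v c q"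

abbreviation "\<V> \<equiv> eq_space v c"

abbreviation "act \<equiv> active v c q"

section \<open>Concave calculus on the effective domain\<close>

lemma ereal_l: "x \<in> effdom L \<Longrightarrow> L x = ereal (l x)"
  using L_less_top[of x] by (cases "L x") (auto simp: effdom_def)

lemma open_effdom: "open (effdom L)"
proof -
  have "effdom L = L -` {-\<infinity><..}" by (auto simp: effdom_def)
  then show ?thesis using continuous_L by (simp add: open_vimage)
qed

text \<open>Concavity bounds \<open>L\<close> from below by a real number; this alone keeps the
  intermediate point in the domain, and then the inequality can be read for
  \<open>l\<close>.\<close>

lemma concave_segment:
  assumes "x \<in> effdom L" "y \<in> effdom L" "0 \<le> t" "t \<le> 1"
  shows "(1 - t) *\<^sub>R x + t *\<^sub>R y \<in> effdom L"
    and "(1 - t) * l x + t * l y \<le> l ((1 - t) *\<^sub>R x + t *\<^sub>R y)"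
proof -
  let ?z = "(1 - t) *\<^sub>R x + t *\<^sub>R y"
  have "ereal (1 - t) * L x + ereal t * L y \<le> L ?z"
    using concave_L assms(3,4) unfolding concave_ereal_def by simp
  then have le: "ereal ((1 - t) * l x + t * l y) \<le> L ?z"
    using ereal_l[OF assms(1)] ereal_l[OF assms(2)]
    by (metis times_ereal.simps(1) plus_ereal.simps(1))
  then show z: "?z \<in> effdom L" unfolding effdom_def using less_le_trans by fastforce
  show "(1 - t) * l x + t * l y \<le> l ?z" using le ereal_l[OF z] by (metis ereal_less_eq(3))
qed

lemma ray_derivative:
  assumes "x \<in> effdom L"
  shows "((\<lambda>t. l (x + t *\<^sub>R w)) has_real_derivative w \<bullet> grad L x) (at 0)"
proof -
  \<comment> \<open>The base point is written as the value of the ray at 0, the form the chain rule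
    expects.\<close>
  have l: "(l has_derivative (\<lambda>h. h \<bullet> grad L x)) (at (x + 0 *\<^sub>R w))"
    using GDERIV_grad[OF differentiable_L[OF assms]] by (simp add: gderiv_def)
  have "((\<lambda>t. x + t *\<^sub>R w) has_derivative (\<lambda>t. t *\<^sub>R w)) (at 0)"
    by (auto intro!: derivative_eq_intros)
  from has_derivative_compose[OF this l]
  show ?thesis by (simp add: has_field_derivative_def mult_commute_abs)
qed

lemma grad_nonpos_if_ray_max:
  assumes x: "x \<in> effdom L" and max: "\<And>t. 0 < t \<Longrightarrow> L (x + t *\<^sub>R w) \<le> L x"
  shows "w \<bullet> grad L x \<le> 0"
proof (rule ccontr)
  assume "\<not> ?thesis"
  then obtain d where d: "0 < d" "\<And>h. 0 < h \<Longrightarrow> h < d \<Longrightarrow> l x < l (x + h *\<^sub>R w)"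
    using DERIV_pos_inc_right[OF ray_derivative[OF x, of w]] by auto
  \<comment> \<open>Since \<open>l\<close> is 0 where \<open>L\<close> is -\<infinity>, growth of
    \<open>l\<close> bears on \<open>L\<close> only inside the domain; openness keeps small
    \<open>t\<close> there.\<close>
  have "((\<lambda>t. x + t *\<^sub>R w) \<longlongrightarrow> x + 0 *\<^sub>R w) (at_right 0)"
    by (intro tendsto_intros)
  then have "\<forall>\<^sub>F t in at_right (0::real). x + t *\<^sub>R w \<in> effdom L"
    using topological_tendstoD[OF _ open_effdom] x by simp
  moreover have "\<forall>\<^sub>F t in at_right (0::real). t \<in> {0<..<d}"
    using d(1) eventually_at_right_real by blast
  ultimately have "\<forall>\<^sub>F t in at_right (0::real). x + t *\<^sub>R w \<in> effdom L \<and> t \<in> {0<..<d}"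
    by (rule eventually_conj)
  then obtain t where t: "x + t *\<^sub>R w \<in> effdom L" "0 < t" "t < d"
    using eventually_happens' trivial_limit_at_right_real by fastforce
  then have "ereal (l (x + t *\<^sub>R w)) \<le> ereal (l x)"
    using max[of t] ereal_l x by metis
  then show False using d(2)[of t] t by simp
qed

text \<open>Concavity keeps \<open>l\<close> above its chord on the segment, whereas a tangent slope
  below the chord slope would make \<open>l\<close> minus the chord decrease at
  \<open>x\<close>.\<close>

lemma concave_below_tangent:
  assumes x: "x \<in> effdom L" and y: "y \<in> effdom L"
  shows "l y - l x \<le> (y - x) \<bullet> grad L x"
proof (rule ccontr)
  assume neg: "\<not> ?thesis"
  have "((\<lambda>t. l (x + t *\<^sub>R (y - x)) - t * (l y - l x)) has_real_derivative
      (y - x) \<bullet> grad L x - (l y - l x)) (at 0)"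
    by (auto intro!: derivative_eq_intros ray_derivative[OF x])
  from DERIV_neg_dec_right[OF this] neg
  obtain d where d: "0 < d"
    "\<And>h. 0 < h \<Longrightarrow> h < d \<Longrightarrow> l (x + h *\<^sub>R (y - x)) - h * (l y - l x) < l x"
    by auto
  \<comment> \<open>Halving stays strictly below \<open>d\<close>; the cap 1 stays on the
    segment.\<close>
  define h where "h = min (d / 2) 1"
  have h: "0 < h" "h < d" "h \<le> 1" using d(1) by (auto simp: h_def min_def)
  have "x + h *\<^sub>R (y - x) = (1 - h) *\<^sub>R x + h *\<^sub>R y" by (simp add: algebra_simps)
  then show False
    using concave_segment(2)[OF x y, of h] d(2)[OF h(1,2)] h by (simp add: algebra_simps)
qed

section \<open>Maximizers over faces\<close>

lemma argmax_le: "x \<in> argmax_on L S \<Longrightarrow> y \<in> S \<Longrightarrow> L y \<le> L x"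
  by (auto simp: argmax_on_def is_arg_max_def not_less)

lemma argmax_mem: "x \<in> argmax_on L S \<Longrightarrow> x \<in> S"
  by (auto simp: argmax_on_def is_arg_max_def)

lemma effdom_mono: "x \<in> effdom L \<Longrightarrow> L x \<le> L y \<Longrightarrow> y \<in> effdom L"
  unfolding effdom_def using less_le_trans by blast

lemma act_subset: "act x \<subseteq> {1..q}"
  by (auto simp: active_def)

text \<open>Feasibility supplies the inequality opposite to the one in
  \<open>active\<close>.\<close>

lemma mem_\<V>_act: "x \<in> \<K> \<Longrightarrow> x \<in> \<V> (act x)"
  unfolding active_def feasible_def eq_space_def by fastforce

lemma act_superset: "A \<subseteq> {1..q} \<Longrightarrow> x \<in> \<V> A \<Longrightarrow> A \<subseteq> act x"
  by (auto simp: active_def eq_space_def)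

lemma \<V>_antimono: "A \<subseteq> B \<Longrightarrow> \<V> B \<subseteq> \<V> A"
  by (auto simp: eq_space_def)

text \<open>A maximizer over \<open>\<V> A\<close> may activate constraints outside
  \<open>A\<close>; the face of all its active constraints is smaller and still contains it. This
  restores the outer invariant once the active set is recomputed.\<close>

lemma argmax_on_act:
  assumes "x \<in> \<K>" "A \<subseteq> {1..q}" "x \<in> argmax_on L (\<V> A)"
  shows "x \<in> argmax_on L (\<V> (act x))"
proof -
  have "\<V> (act x) \<subseteq> \<V> A"
    using \<V>_antimono[OF act_superset[OF assms(2) argmax_mem[OF assms(3)]]] .
  then show ?thesis
    using assms(3) mem_\<V>_act[OF assms(1)] by (auto simp: argmax_on_def is_arg_max_def)
qed

text \<open>The point \<open>x\<close> witnesses that the face meets the domain, so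
  \<open>candidate\<close> is defined along the whole run.\<close>

lemma psi_tilde_props:
  assumes "A \<subseteq> {1..q}" "x \<in> \<V> A" "x \<in> effdom L"
  shows "candidate v c L psi_tilde A = Some (psi_tilde A)"
    and "psi_tilde A \<in> \<V> A" and "L x \<le> L (psi_tilde A)" and "psi_tilde A \<in> effdom L"
proof -
  have ne: "\<V> A \<inter> effdom L \<noteq> {}" using assms by blast
  then show "candidate v c L psi_tilde A = Some (psi_tilde A)" by (simp add: candidate_def)
  show "psi_tilde A \<in> \<V> A" and *: "L x \<le> L (psi_tilde A)"
    using psi_tilde_argmax[OF assms(1) ne] assms(2) argmax_mem argmax_le by blast+
  show "psi_tilde A \<in> effdom L" using effdom_mono[OF assms(3) *] .
qed

section \<open>The gradient at a maximizer over a face\<close>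

text \<open>Both \<open>w\<close> and \<open>- w\<close> stay in the face, so the one-sided bound
  applies to each.\<close>

lemma grad_zero_on_face:
  assumes x: "x \<in> effdom L" "x \<in> argmax_on L (\<V> A)" and w: "\<And>a. a \<in> A \<Longrightarrow> v a \<bullet> w = 0"
  shows "w \<bullet> grad L x = 0"
proof -
  have "L (x + t *\<^sub>R w) \<le> L x" for t
    using argmax_le[OF x(2)] argmax_mem[OF x(2)] w by (simp add: eq_space_def inner_add_right)
  from this this[of "- _"] have "w \<bullet> grad L x \<le> 0" "(- w) \<bullet> grad L x \<le> 0"
    by (intro grad_nonpos_if_ray_max[OF x(1)]; simp)+
  then show ?thesis by simp
qed

lemma grad_decomposition:
  assumes x: "x \<in> effdom L" "x \<in> argmax_on L (\<V> A)" and A: "A \<subseteq> {1..q}"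
  shows "w \<bullet> grad L x = (\<Sum>a\<in>A. (v a \<bullet> w) / (v a \<bullet> b a) * (b a \<bullet> grad L x))"
proof -
  \<comment> \<open>The coefficients remove the part of \<open>w\<close> seen by the
    \<open>v a\<close>: by duality \<open>u\<close> is tangent to the face, where the gradient
    vanishes.\<close>
  define u where "u = w - (\<Sum>a\<in>A. ((v a \<bullet> w) / (v a \<bullet> b a)) *\<^sub>R b a)"
  have fin: "finite A" using A finite_subset by blast
  have "v i \<bullet> u = 0" if i: "i \<in> A" for i
  proof -
    have "v i \<bullet> (\<Sum>a\<in>A. ((v a \<bullet> w) / (v a \<bullet> b a)) *\<^sub>R b a)
        = (\<Sum>a\<in>A. if a = i then v i \<bullet> w else 0)"
      unfolding inner_sum_right
    proof (rule sum.cong[OF refl])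
      fix a assume "a \<in> A"
      then have "a \<in> {1..q}" "i \<in> {1..q}" using A i by auto
      then show "v i \<bullet> (((v a \<bullet> w) / (v a \<bullet> b a)) *\<^sub>R b a) = (if a = i then v i \<bullet> w else 0)"
        using v_b_neg[of i] v_b_orth[of i a] by (cases "a = i") simp_all
    qed
    then show ?thesis using i fin by (simp add: u_def inner_diff_right)
  qed
  then have "u \<bullet> grad L x = 0" using grad_zero_on_face[OF x] by blast
  then show ?thesis by (simp add: u_def inner_diff_left inner_sum_left)
qed

section \<open>The inner loop\<close>

text \<open>Constraints violated by the candidate are assumed slack at \<open>\<psi>\<close>, so the
  step length exists and is positive. A truncated step keeps \<open>A\<close> active and adds a
  constraint, so \<open>q - card A\<close> drops. Ending in some \<open>psi_tilde B\<close> leaves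
  finitely many results, on which termination of the outer loop rests.\<close>

lemma move_to_candidate_result:
  assumes "\<psi> \<in> \<K>" "\<psi> \<in> effdom L" "A \<subseteq> {1..q}" "\<psi> \<in> \<V> A"
    and "\<And>i. i \<in> {1..q} \<Longrightarrow> c i < v i \<bullet> psi_tilde A \<Longrightarrow> v i \<bullet> \<psi> < c i"
  shows "\<exists>B\<subseteq>{1..q}. move_to_candidate v c q L psi_tilde \<psi> (psi_tilde A) = Some (psi_tilde B)
    \<and> psi_tilde B \<in> \<K> \<and> psi_tilde B \<in> effdom L \<and> psi_tilde B \<in> argmax_on L (\<V> B)
    \<and> L \<psi> \<le> L (psi_tilde B) \<and> (L \<psi> < L (psi_tilde A) \<longrightarrow> L \<psi> < L (psi_tilde B))"
  using assms
proof (induction "q - card A" arbitrary: A \<psi> rule: less_induct)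
  case less
  let ?cand = "psi_tilde A"
  note cand = psi_tilde_props[OF less.prems(3,4,2)]
  show ?case
  proof (cases "?cand \<in> \<K>")
    case True
    have "?cand \<in> argmax_on L (\<V> A)"
      using psi_tilde_argmax less.prems by blast
    then show ?thesis
      using True cand less.prems(3) by (subst move_to_candidate.simps) (auto intro!: exI[of _ A])
  next
    case False
    define I where "I = {i\<in>{1..q}. v i \<bullet> ?cand > c i}"
    define r where "r = (\<lambda>i. (c i - v i \<bullet> \<psi>) / (v i \<bullet> ?cand - v i \<bullet> \<psi>))"
    define t where "t = Min (r ` I)"
    have step: "step_length v c q \<psi> ?cand = Some t"
      unfolding t_def r_def I_def using step_length_eq_Min[OF less.prems(1) False less.prems(5)] .
    have "I \<noteq> {}" using False unfolding I_def feasible_def by fastforce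
    have "finite I" by (simp add: I_def)
    with \<open>I \<noteq> {}\<close> have "t \<in> r ` I" unfolding t_def by simp
    \<comment> \<open>A constraint attaining the minimal ratio: it stops the step and becomes
      tight.\<close>
    then obtain k where k: "k \<in> I" "t = r k" by blast
    have vk: "v k \<bullet> \<psi> < c k" "c k < v k \<bullet> ?cand" "k \<in> {1..q}"
      using k(1) less.prems(5) by (auto simp: I_def)
    then have t: "0 < t" "t < 1" by (auto simp: k(2) r_def)
    define \<psi>' where "\<psi>' = (1 - t) *\<^sub>R \<psi> + t *\<^sub>R ?cand"
    have t_le: "t \<le> r i" if "i \<in> I" for i
      using that \<open>finite I\<close> by (simp add: t_def)
    have \<psi>'_dom: "\<psi>' \<in> effdom L" and \<psi>'_val: "(1 - t) * l \<psi> + t * l ?cand \<le> l \<psi>'"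
      unfolding \<psi>'_def using concave_segment[OF less.prems(2) cand(4)] t by auto
    have inner_\<psi>': "v i \<bullet> \<psi>' = v i \<bullet> \<psi> + t * (v i \<bullet> ?cand - v i \<bullet> \<psi>)" for i
      by (simp add: \<psi>'_def inner_add_right algebra_simps)
    have \<psi>'_K: "\<psi>' \<in> \<K>"
      unfolding feasible_def
    proof (clarify)
      fix i assume i: "i \<in> {1..q}"
      have \<psi>_i: "v i \<bullet> \<psi> \<le> c i" using less.prems(1) i by (simp add: feasible_def)
      show "v i \<bullet> \<psi>' \<le> c i"
      proof (cases "i \<in> I")
        case True
        then have "0 < v i \<bullet> ?cand - v i \<bullet> \<psi>" using \<psi>_i by (auto simp: I_def)
        then show ?thesis
          using t_le[OF True] by (simp add: inner_\<psi>' r_def pos_le_divide_eq)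
      next
        case False
        then have "v i \<bullet> ?cand \<le> c i" using i by (simp add: I_def)
        then show ?thesis
          using convex_bound_le[of "v i \<bullet> \<psi>" "c i" "v i \<bullet> ?cand" "1 - t" t] t \<psi>_i
          by (simp add: \<psi>'_def inner_add_right)
      qed
    qed
    have "\<psi>' \<in> \<V> A"
      using less.prems(4) cand(2) by (simp add: eq_space_def inner_\<psi>')
    then have "A \<subseteq> act \<psi>'" using act_superset less.prems(3) by blast
    moreover have "v k \<bullet> \<psi>' = c k" using vk by (simp add: inner_\<psi>' k(2) r_def)
    then have "k \<in> act \<psi>'" using vk by (simp add: active_def)
    \<comment> \<open>Constraints in \<open>A\<close> are tight at \<open>\<psi>\<close>, whereas
      \<open>k\<close> is slack there.\<close>
    moreover have "k \<notin> A" using less.prems(4) vk by (auto simp: eq_space_def)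
    ultimately have "A \<subset> act \<psi>'" by blast
    then have "card A < card (act \<psi>')"
      using act_subset by (meson finite_atLeastAtMost finite_subset psubset_card_mono)
    moreover have "card (act \<psi>') \<le> q" using card_mono[OF _ act_subset] by simp
    ultimately have decr: "q - card (act \<psi>') < q - card A" by simp
    note \<psi>'_V = mem_\<V>_act[OF \<psi>'_K]
    note cand' = psi_tilde_props[OF act_subset \<psi>'_V \<psi>'_dom]
    \<comment> \<open>The new candidate meets all constraints active at \<open>\<psi>'\<close> with
      equality, so any it violates is slack at \<open>\<psi>'\<close>.\<close>
    have slack: "v i \<bullet> \<psi>' < c i" if "i \<in> {1..q}" "c i < v i \<bullet> psi_tilde (act \<psi>')" for i
      using that cand'(2) by (auto simp: eq_space_def active_def not_le)
    have move: "move_to_candidate v c q L psi_tilde \<psi> ?cand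
        = move_to_candidate v c q L psi_tilde \<psi>' (psi_tilde (act \<psi>'))"
      using False cand'(1) by (subst move_to_candidate.simps) (simp add: step Let_def flip: \<psi>'_def)
    have l_le: "l \<psi> \<le> l ?cand"
      using cand(3) ereal_l[OF cand(4)] ereal_l[OF less.prems(2)] by (metis ereal_less_eq(3))
    then have "t * l \<psi> \<le> t * l ?cand" using t by simp
    then have "l \<psi> \<le> l \<psi>'" using \<psi>'_val by (simp add: algebra_simps)
    then have ge: "L \<psi> \<le> L \<psi>'" using ereal_l \<psi>'_dom less.prems(2) by (metis ereal_less_eq(3))
    \<comment> \<open>As \<open>t\<close> is positive, a strict gain at the candidate gives one at
      \<open>\<psi>'\<close>; the remaining steps only have to preserve it.\<close>
    have gt: "L \<psi> < L \<psi>'" if "L \<psi> < L ?cand"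
    proof -
      have "l \<psi> < l ?cand" using that ereal_l cand(4) less.prems(2) by (metis less_ereal.simps(1))
      then have "t * l \<psi> < t * l ?cand" using t by simp
      then have "l \<psi> < l \<psi>'" using \<psi>'_val by (simp add: algebra_simps)
      then show ?thesis using ereal_l \<psi>'_dom less.prems(2) by (metis less_ereal.simps(1))
    qed
    from less.hyps[OF decr \<psi>'_K \<psi>'_dom act_subset \<psi>'_V slack]
    obtain B where "B \<subseteq> {1..q}"
      "move_to_candidate v c q L psi_tilde \<psi>' (psi_tilde (act \<psi>')) = Some (psi_tilde B)"
      "psi_tilde B \<in> \<K>" "psi_tilde B \<in> effdom L" "psi_tilde B \<in> argmax_on L (\<V> B)"
      "L \<psi>' \<le> L (psi_tilde B)"
      by blast
    then show ?thesis using move ge gt by (metis less_le_trans order_trans)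
  qed
qed

section \<open>The outer loop\<close>

lemma release_loop_result:
  assumes "\<psi> \<in> \<K>" "\<psi> \<in> effdom L" "\<psi> \<in> argmax_on L (\<V> (act \<psi>))"
  shows "\<exists>\<psi>'. release_loop v c q L psi_tilde b \<psi> (act \<psi>) = Some \<psi>' \<and> \<psi>' \<in> argmax_on L \<K>"
  using assms
\<comment> \<open>The measure counts index sets whose candidate beats \<open>\<psi>\<close>. As
  \<open>psi_tilde\<close> is total, sets without a defined candidate may be counted too; the count
  stays finite.\<close>
proof (induction "card {B. B \<subseteq> {1..q} \<and> L \<psi> < L (psi_tilde B)}" arbitrary: \<psi> rule: less_induct)
  case less
  let ?A = "act \<psi>"
  let ?g = "\<lambda>a. b a \<bullet> grad L \<psi>"
  have fin: "finite ?A" using act_subset finite_subset by blast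
  note decomposition = grad_decomposition[OF less.prems(2,3) act_subset]
  show ?case
  proof (cases "?A \<noteq> {} \<and> Max (?g ` ?A) > 0")
    case False
    then have g: "?g a \<le> 0" if "a \<in> ?A" for a
    proof -
      have "?g a \<le> Max (?g ` ?A)" using that fin by simp
      moreover have "Max (?g ` ?A) \<le> 0" using False that by fastforce
      ultimately show ?thesis by simp
    qed
    have "L y \<le> L \<psi>" if y: "y \<in> \<K>" for y
    proof (cases "y \<in> effdom L")
      case True
      \<comment> \<open>A feasible \<open>y\<close> has nonnegative coefficients along the active
        \<open>b a\<close>, where the gradient is nonpositive.\<close>
      have "(v a \<bullet> (y - \<psi>)) / (v a \<bullet> b a) * ?g a \<le> 0" if a: "a \<in> ?A" for a
      proof -
        have "a \<in> {1..q}" using a act_subset by blast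
        moreover have "v a \<bullet> \<psi> = c a" using mem_\<V>_act[OF less.prems(1)] a by (simp add: eq_space_def)
        ultimately have "v a \<bullet> (y - \<psi>) \<le> 0" "v a \<bullet> b a < 0"
          using y v_b_neg by (auto simp: feasible_def inner_diff_right)
        then show ?thesis
          using g[OF a] by (intro mult_nonneg_nonpos divide_nonpos_neg)
      qed
      then have "(y - \<psi>) \<bullet> grad L \<psi> \<le> 0" by (subst decomposition) (rule sum_nonpos)
      then have "l y \<le> l \<psi>" using concave_below_tangent[OF less.prems(2) True] by simp
      then show ?thesis using ereal_l True less.prems(2) by (metis ereal_less_eq(3))
    qed (simp add: effdom_def)
    then have "\<psi> \<in> argmax_on L \<K>"
      using less.prems(1) by (auto simp: argmax_on_def is_arg_max_def not_less)
    then show ?thesis using False by (subst release_loop.simps) auto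
  next
    case True
    define a where "a = (LEAST a. a \<in> argmax_on ?g ?A)"
    have "Max (?g ` ?A) \<in> ?g ` ?A" using True fin by simp
    then obtain a0 where a0: "a0 \<in> ?A" "?g a0 = Max (?g ` ?A)" by fastforce
    then have "a0 \<in> argmax_on ?g ?A"
      using fin by (auto simp: argmax_on_def is_arg_max_def not_less)
    then have "a \<in> argmax_on ?g ?A" unfolding a_def by (rule LeastI)
    then have a: "a \<in> ?A" "0 < ?g a"
      using a0 True by (auto simp: argmax_on_def is_arg_max_def not_less)
    then have a_q: "a \<in> {1..q}" using act_subset by blast
    let ?B = "?A - {a}"
    have B: "?B \<subseteq> {1..q}" using act_subset by blast
    have \<psi>_B: "\<psi> \<in> \<V> ?B" using mem_\<V>_act[OF less.prems(1)] \<V>_antimono by blast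
    note cand = psi_tilde_props[OF B \<psi>_B less.prems(2)]
    \<comment> \<open>The ray along \<open>b a\<close> stays in \<open>\<V> ?B\<close>; without a
      strict gain \<open>\<psi>\<close> would be maximal on it, against the positive slope.\<close>
    have strict: "L \<psi> < L (psi_tilde ?B)"
    proof (rule ccontr)
      assume le: "\<not> ?thesis"
      have "L (\<psi> + t *\<^sub>R b a) \<le> L \<psi>" for t
      proof -
        have "\<psi> + t *\<^sub>R b a \<in> \<V> ?B"
          using \<psi>_B B a_q v_b_orth by (auto simp: eq_space_def inner_add_right subset_iff)
        then have "L (\<psi> + t *\<^sub>R b a) \<le> L (psi_tilde ?B)"
          using argmax_le psi_tilde_argmax[OF B] \<psi>_B less.prems(2) by blast
        then show ?thesis using le by simp
      qed
      then show False using grad_nonpos_if_ray_max[OF less.prems(2), of "b a"] a(2) by simp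
    qed
    have v_a: "v a \<bullet> psi_tilde ?B \<le> c a"
    proof -
      let ?w = "psi_tilde ?B - \<psi>"
      have "l \<psi> < l (psi_tilde ?B)"
        using strict ereal_l cand(4) less.prems(2) by (metis less_ereal.simps(1))
      then have "0 < ?w \<bullet> grad L \<psi>"
        using concave_below_tangent[OF less.prems(2) cand(4)] by simp
      \<comment> \<open>Both points lie in \<open>\<V> ?B\<close>, so only the released constraint
        contributes, and its sign can be read off.\<close>
      also have "\<dots> = (\<Sum>i\<in>?A. if i = a then (v a \<bullet> ?w) / (v a \<bullet> b a) * ?g a else 0)"
        using cand(2) \<psi>_B
        by (subst decomposition, intro sum.cong) (auto simp: eq_space_def inner_diff_right)
      also have "\<dots> = (v a \<bullet> ?w) / (v a \<bullet> b a) * ?g a" using fin a(1) by simp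
      finally have "0 < (v a \<bullet> ?w) / (v a \<bullet> b a)" using a(2) by (rule zero_less_mult_pos2)
      then have "v a \<bullet> ?w < 0" using v_b_neg[OF a_q] by (simp add: zero_less_divide_iff)
      moreover have "v a \<bullet> \<psi> = c a" using mem_\<V>_act[OF less.prems(1)] a by (simp add: eq_space_def)
      ultimately show ?thesis by (simp add: inner_diff_right)
    qed
    \<comment> \<open>The candidate keeps the other active constraints tight and does not violate
      \<open>a\<close>.\<close>
    have slack: "v i \<bullet> \<psi> < c i" if i: "i \<in> {1..q}" "c i < v i \<bullet> psi_tilde ?B" for i
    proof (rule ccontr)
      assume "\<not> ?thesis"
      then have "i \<in> ?A" using i(1) by (simp add: active_def)
      moreover have "i \<noteq> a" using i v_a by auto
      ultimately show False using cand(2) i(2) by (auto simp: eq_space_def)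
    qed
    from move_to_candidate_result[OF less.prems(1,2) B \<psi>_B slack] strict
    obtain C where C: "C \<subseteq> {1..q}"
      "move_to_candidate v c q L psi_tilde \<psi> (psi_tilde ?B) = Some (psi_tilde C)"
      "psi_tilde C \<in> \<K>" "psi_tilde C \<in> effdom L" "psi_tilde C \<in> argmax_on L (\<V> C)"
      "L \<psi> < L (psi_tilde C)"
      by blast
    \<comment> \<open>The set \<open>C\<close> itself is counted before the pass but not after
      it.\<close>
    have "{B. B \<subseteq> {1..q} \<and> L (psi_tilde C) < L (psi_tilde B)}
        \<subset> {B. B \<subseteq> {1..q} \<and> L \<psi> < L (psi_tilde B)}"
      using C(1,6) by (auto dest: less_trans)
    then have decr: "card {B. B \<subseteq> {1..q} \<and> L (psi_tilde C) < L (psi_tilde B)}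
        < card {B. B \<subseteq> {1..q} \<and> L \<psi> < L (psi_tilde B)}"
      by (intro psubset_card_mono) auto
    have "release_loop v c q L psi_tilde b \<psi> ?A
        = release_loop v c q L psi_tilde b (psi_tilde C) (act (psi_tilde C))"
      using True by (subst release_loop.simps) (simp add: Let_def cand(1) C(2) flip: a_def)
    then show ?thesis using less.hyps[OF decr C(3,4) argmax_on_act[OF C(3,1,5)]] by simp
  qed
qed

section \<open>The complete algorithm\<close>

text \<open>The starting point need not be optimal on its face; the first inner loop establishes the
  invariant of the outer one.\<close>

lemma ActiveSet1_result:
  assumes "\<psi>\<^sub>o \<in> \<K>" "\<psi>\<^sub>o \<in> effdom L"
  shows "\<exists>\<psi>. ActiveSet1 v c q L psi_tilde b \<psi>\<^sub>o = Some \<psi> \<and> \<psi> \<in> argmax_on L \<K>"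
proof -
  let ?A = "act \<psi>\<^sub>o"
  note V = mem_\<V>_act[OF assms(1)]
  note cand = psi_tilde_props[OF act_subset V assms(2)]
  have slack: "v i \<bullet> \<psi>\<^sub>o < c i" if "i \<in> {1..q}" "c i < v i \<bullet> psi_tilde ?A" for i
    using that cand(2) by (auto simp: eq_space_def active_def not_le)
  from move_to_candidate_result[OF assms act_subset V slack]
  obtain B where B: "B \<subseteq> {1..q}"
    "move_to_candidate v c q L psi_tilde \<psi>\<^sub>o (psi_tilde ?A) = Some (psi_tilde B)"
    "psi_tilde B \<in> \<K>" "psi_tilde B \<in> effdom L" "psi_tilde B \<in> argmax_on L (\<V> B)"
    by blast
  then show ?thesis
    using release_loop_result[OF B(3,4) argmax_on_act[OF B(3,1,5)]]
    by (simp add: ActiveSet1_def cand(1))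
qed

end

theorem mainTheorem3:
  fixes L :: "real ^ 'm \<Rightarrow> ereal"
    and v b :: "nat \<Rightarrow> real ^ 'm" and c :: "nat \<Rightarrow> real" and q :: nat
    and psi_tilde :: "nat set \<Rightarrow> real ^ 'm" and \<psi>\<^sub>o :: "real ^ 'm"
  assumes "\<forall>\<psi>. L \<psi> < \<infinity>"
    and "continuous_on UNIV L"
    and "concave_ereal L"
    and "(L \<longlongrightarrow> -\<infinity>) at_infinity"
    and "cont_differentiable_on_effdom L"
    and "inj_on v {1..q}" and "independent (v ` {1..q})"
    and "inj_on b {1..CARD('m)}" and "independent (b ` {1..CARD('m)})"
    and "span (b ` {1..CARD('m)}) = UNIV"
    and "\<forall>i\<in>{1..q}. \<forall>j\<in>{1..CARD('m)}.
           (i = j \<longrightarrow> v i \<bullet> b j < 0) \<and> (i \<noteq> j \<longrightarrow> v i \<bullet> b j = 0)"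
    and "\<forall>A\<subseteq>{1..q}. eq_space v c A \<inter> effdom L \<noteq> {} \<longrightarrow>
           psi_tilde A \<in> argmax_on L (eq_space v c A)"
    and "\<psi>\<^sub>o \<in> feasible v c q \<inter> effdom L"
  shows "\<exists>\<psi>. ActiveSet1 v c q L psi_tilde b \<psi>\<^sub>o = Some \<psi> \<and> \<psi> \<in> argmax_on L (feasible v c q)"
proof -
  \<comment> \<open>Independence gives \<open>q\<close> at most the dimension, so the sign
    conditions cover all \<open>b j\<close> with \<open>j\<close> up to \<open>q\<close>.\<close>
  have "q = card (v ` {1..q})" using assms(6) by (simp add: card_image)
  also have "\<dots> \<le> CARD('m)"
    using independent_bound[OF assms(7)] by simp
  finally have q: "{1..q} \<subseteq> {1..CARD('m)}" by simp
  interpret active_set_problem L v b c q psi_tilde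
  proof
    show "L x < \<infinity>" for x using assms(1) by simp
    show "continuous_on UNIV L" "concave_ereal L" by fact+
    show "(\<lambda>x. real_of_ereal (L x)) differentiable (at x)" if "x \<in> effdom L" for x
      using assms(5) that unfolding cont_differentiable_on_effdom_def by blast
    show "v i \<bullet> b i < 0" if "i \<in> {1..q}" for i
      using assms(11) that q by blast
    show "v i \<bullet> b j = 0" if "i \<in> {1..q}" "j \<in> {1..q}" "i \<noteq> j" for i j
      using assms(11) that q by blast
    show "psi_tilde A \<in> argmax_on L (eq_space v c A)"
      if "A \<subseteq> {1..q}" "eq_space v c A \<inter> effdom L \<noteq> {}" for A
      using assms(12) that by blast
  qed
  show ?thesis using ActiveSet1_result assms(13) by blast
qed

end
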